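(* Let $R$ be a commutative ring and let $X$ be a dg algebra over $R$. Consider a special deformation retract of complexes of $R$-modules $$i\colon (Y,\partial^Y)\to (X,\partial^X),\qquad p\colon (X,\partial^X)\to (Y,\partial^Y),$$ with associated homotopy $h$ on $X$ that satisfies the generalized Leibniz rule, and let $\delta$ be a small perturbation on $X$. Let $(X,\partial^X_\infty)$, $(Y,\partial^Y_\infty)$, $i_\infty$, $p_\infty$ be the perturbed data. If the perturbed complex $(X,\partial^X_\infty)$ remains a dg algebra via the same product (equivalently, if $\delta$ satisfies the Leibniz rule), then the product $$\alpha\beta := p_\infty\bigl(i_\infty(\alpha)\,i_\infty(\beta)\bigr)\qquad\text{for }\alpha,\beta\in Y,$$ where the product inside the parentheses is the one in $X$, defines a dg algebra structure on the perturbed complex $(Y,\partial^Y_\infty)$. Moreover, with this structure on $Y$, the map $i_\infty$ is a homomorphism of dg algebras.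
   Context: Complexes are complexes of $R$-modules, graded homologically (differentials have degree $-1$). A dg algebra over $R$ is a complex $(X,\partial)$ of $R$-modules in nonnegative degrees with an associative, unitary product ($1\in X_0$) given by a chain map $X\otimes_R X\to X$ (equivalently, $\partial$ satisfies the Leibniz rule $\partial(\alpha\beta)=\partial(\alpha)\beta+(-1)^{|\alpha|}\alpha\partial(\beta)$), which is strictly graded commutative: $\alpha\beta=(-1)^{|\alpha||\beta|}\beta\alpha$, and $\alpha^2=0$ for $|\alpha|$ odd. A homomorphism of dg algebras is a morphism of complexes $\phi$ with $\phi(1)=1$ and $\phi(\alpha\beta)=\phi(\alpha)\phi(\beta)$. A deformation retract consists of quasi-isomorphisms of complexes $i\colon Y\to X$, $p\colon X\to Y$ and a homotopy $h$ on $X$ (graded $R$-linear of degree $1$) with $ip=1+\partial^Xh+h\partial^X$ and $pi=1$. It is special if in addition $hi=0$, $ph=0$ and $h^2=0$. $h$ satisfies the generalized Leibniz rule if $h(\alpha\beta)\in h(\alpha)X+Xh(\beta)$ for all $\alpha,\beta\in X$. A perturbation is a map $\delta$ on $X$ of the same degree as $\partial^X$ such that $(\partial^X+\delta)^2=0$; it is small if $1-\delta h$ is invertible. For a small perturbation put $A=(1-\delta h)^{-1}\delta$. The perturbed data are $$i_\infty=i+hAi,\quad p_\infty=p+pAh,\quad \partial^X_\infty=\partial^X+\delta,\quad \partial^Y_\infty=\partial^Y+pAi,\quad h_\infty=h+hAh.$$ By the Perturbation Lemma, these form again a special deformation retract $i_\infty\colon(Y,\partial^Y_\infty)\to(X,\partial^X_\infty)$,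 $p_\infty\colon (X,\partial^X_\infty)\to(Y,\partial^Y_\infty)$ with associated homotopy $h_\infty$.
   Formalization: The unit of Y and i_∞(1)=1 are claimed only if h(1)=0, which is necessary: for X=R⊕Ru, du=-1, h(1)=u, Y=0, δ=0, the map i_∞ is not unital. All other dg algebra axioms on Y, and that i_∞ is a multiplicative chain map, are proved without it. *)

theory Defs
  imports Complex_Main
begin

text \<open>
  A graded \<open>R\<close>-module is given by its total module (the whole type \<open>'a\<close>, with scalar
  multiplication \<open>s\<close>) together with an internal direct sum decomposition \<open>G n\<close>, \<open>n\<close> an integer.
  Maps are maps of total modules, so that composites and inverses are the ordinary ones.
\<close>

locale graded_module = module s
  for s :: "'r::comm_ring_1 \<Rightarrow> 'a::ab_group_add \<Rightarrow> 'a" +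
  fixes G :: "int \<Rightarrow> 'a set"
  assumes subspace_component: "subspace (G n)"
    and component_sum: "\<exists>N c. finite N \<and> (\<forall>n\<in>N. c n \<in> G n) \<and> x = (\<Sum>n\<in>N. c n)"
    and component_indep:
      "\<lbrakk>finite N; \<forall>n\<in>N. c n \<in> G n; (\<Sum>n\<in>N. c n) = 0\<rbrakk> \<Longrightarrow> \<forall>n\<in>N. c n = 0"

definition graded_map ::
  "('r::comm_ring_1 \<Rightarrow> 'a::ab_group_add \<Rightarrow> 'a) \<Rightarrow> (int \<Rightarrow> 'a set) \<Rightarrow>
   ('r \<Rightarrow> 'b::ab_group_add \<Rightarrow> 'b) \<Rightarrow> (int \<Rightarrow> 'b set) \<Rightarrow> int \<Rightarrow> ('a \<Rightarrow> 'b) \<Rightarrow> bool" where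
  "graded_map s G s' G' k f \<longleftrightarrow> module_hom s s' f \<and> (\<forall>n. f ` G n \<subseteq> G' (n + k))"

locale chain_complex = graded_module s G
  for s :: "'r::comm_ring_1 \<Rightarrow> 'a::ab_group_add \<Rightarrow> 'a" and G :: "int \<Rightarrow> 'a set" +
  fixes d :: "'a \<Rightarrow> 'a"
  assumes graded_map_d: "graded_map s G s G (- 1) d"
    and d_d: "d (d x) = 0"

definition chain_map ::
  "('r::comm_ring_1 \<Rightarrow> 'a::ab_group_add \<Rightarrow> 'a) \<Rightarrow> (int \<Rightarrow> 'a set) \<Rightarrow> ('a \<Rightarrow> 'a) \<Rightarrow>
   ('r \<Rightarrow> 'b::ab_group_add \<Rightarrow> 'b) \<Rightarrow> (int \<Rightarrow> 'b set) \<Rightarrow> ('b \<Rightarrow> 'b) \<Rightarrow> ('a \<Rightarrow> 'b) \<Rightarrow> bool" where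
  "chain_map s G d s' G' d' f \<longleftrightarrow>
     chain_complex s G d \<and> chain_complex s' G' d' \<and>
     graded_map s G s' G' 0 f \<and> (\<forall>x. f (d x) = d' (f x))"

definition cycles :: "(int \<Rightarrow> 'a::ab_group_add set) \<Rightarrow> ('a \<Rightarrow> 'a) \<Rightarrow> int \<Rightarrow> 'a set" where
  "cycles G d n = {z \<in> G n. d z = 0}"

definition homologous ::
  "(int \<Rightarrow> 'a::ab_group_add set) \<Rightarrow> ('a \<Rightarrow> 'a) \<Rightarrow> int \<Rightarrow> ('a \<times> 'a) set" where
  "homologous G d n =
     {(z, w). z \<in> cycles G d n \<and> w \<in> cycles G d n \<and> z - w \<in> d ` G (n + 1)}"

definition homology :: "(int \<Rightarrow> 'a::ab_group_add set) \<Rightarrow> ('a \<Rightarrow> 'a) \<Rightarrow> int \<Rightarrow> 'a set set" where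
  "homology G d n = cycles G d n // homologous G d n"

text \<open>The induced map \<open>[z] \<mapsto> [f z]\<close> on homology; it is linear, so bijectivity is isomorphism.\<close>

definition homology_map ::
  "(int \<Rightarrow> 'b::ab_group_add set) \<Rightarrow> ('b \<Rightarrow> 'b) \<Rightarrow> int \<Rightarrow> ('a \<Rightarrow> 'b) \<Rightarrow> 'a set \<Rightarrow> 'b set" where
  "homology_map G' d' n f C = homologous G' d' n `` (f ` C)"

definition quasi_isomorphism ::
  "('r::comm_ring_1 \<Rightarrow> 'a::ab_group_add \<Rightarrow> 'a) \<Rightarrow> (int \<Rightarrow> 'a set) \<Rightarrow> ('a \<Rightarrow> 'a) \<Rightarrow>
   ('r \<Rightarrow> 'b::ab_group_add \<Rightarrow> 'b) \<Rightarrow> (int \<Rightarrow> 'b set) \<Rightarrow> ('b \<Rightarrow> 'b) \<Rightarrow> ('a \<Rightarrow> 'b) \<Rightarrow> bool" where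
  "quasi_isomorphism s G d s' G' d' f \<longleftrightarrow>
     chain_map s G d s' G' d' f \<and>
     (\<forall>n. bij_betw (homology_map G' d' n f) (homology G d n) (homology G' d' n))"

definition koszul_sign :: "int \<Rightarrow> 'a::ab_group_add \<Rightarrow> 'a" where
  "koszul_sign n x = (if even n then x else - x)"

text \<open>
  All axioms of a dg algebra except the unit: bilinearity, compatibility with degrees and the
  Leibniz rule say that the product is a chain map on the tensor square.
\<close>

locale nonunital_dg_algebra = chain_complex s G d
  for s :: "'r::comm_ring_1 \<Rightarrow> 'a::ab_group_add \<Rightarrow> 'a" and G :: "int \<Rightarrow> 'a set"
    and d :: "'a \<Rightarrow> 'a" +
  fixes m :: "'a \<Rightarrow> 'a \<Rightarrow> 'a"
  assumes nonneg: "n < 0 \<Longrightarrow> G n = {0}"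
    and linear_right: "module_hom s s (\<lambda>b. m a b)"
    and linear_left: "module_hom s s (\<lambda>a. m a b)"
    and degree_mult: "\<lbrakk>a \<in> G k; b \<in> G l\<rbrakk> \<Longrightarrow> m a b \<in> G (k + l)"
    and leibniz: "\<lbrakk>a \<in> G k; b \<in> G l\<rbrakk> \<Longrightarrow> d (m a b) = m (d a) b + koszul_sign k (m a (d b))"
    and assoc: "m (m a b) c = m a (m b c)"
    and graded_commute: "\<lbrakk>a \<in> G k; b \<in> G l\<rbrakk> \<Longrightarrow> m a b = koszul_sign (k * l) (m b a)"
    and odd_square: "\<lbrakk>a \<in> G k; odd k\<rbrakk> \<Longrightarrow> m a a = 0"

locale dg_algebra = nonunital_dg_algebra s G d m
  for s :: "'r::comm_ring_1 \<Rightarrow> 'a::ab_group_add \<Rightarrow> 'a" and G :: "int \<Rightarrow> 'a set"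
    and d :: "'a \<Rightarrow> 'a" and m :: "'a \<Rightarrow> 'a \<Rightarrow> 'a" +
  fixes e :: 'a
  assumes unit_degree: "e \<in> G 0"
    and unit_left: "m e a = a"
    and unit_right: "m a e = a"

definition multiplicative :: "('a \<Rightarrow> 'a \<Rightarrow> 'a) \<Rightarrow> ('b \<Rightarrow> 'b \<Rightarrow> 'b) \<Rightarrow> ('a \<Rightarrow> 'b) \<Rightarrow> bool" where
  "multiplicative m m' f \<longleftrightarrow> (\<forall>a b. f (m a b) = m' (f a) (f b))"

definition dg_algebra_hom ::
  "('r::comm_ring_1 \<Rightarrow> 'a::ab_group_add \<Rightarrow> 'a) \<Rightarrow> (int \<Rightarrow> 'a set) \<Rightarrow> ('a \<Rightarrow> 'a) \<Rightarrow>
     ('a \<Rightarrow> 'a \<Rightarrow> 'a) \<Rightarrow> 'a \<Rightarrow>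
   ('r \<Rightarrow> 'b::ab_group_add \<Rightarrow> 'b) \<Rightarrow> (int \<Rightarrow> 'b set) \<Rightarrow> ('b \<Rightarrow> 'b) \<Rightarrow>
     ('b \<Rightarrow> 'b \<Rightarrow> 'b) \<Rightarrow> 'b \<Rightarrow> ('a \<Rightarrow> 'b) \<Rightarrow> bool" where
  "dg_algebra_hom s G d m e s' G' d' m' e' f \<longleftrightarrow>
     dg_algebra s G d m e \<and> dg_algebra s' G' d' m' e' \<and>
     chain_map s G d s' G' d' f \<and> multiplicative m m' f \<and> f e = e'"

definition deformation_retract ::
  "('r::comm_ring_1 \<Rightarrow> 'x::ab_group_add \<Rightarrow> 'x) \<Rightarrow> (int \<Rightarrow> 'x set) \<Rightarrow> ('x \<Rightarrow> 'x) \<Rightarrow>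
   ('r \<Rightarrow> 'y::ab_group_add \<Rightarrow> 'y) \<Rightarrow> (int \<Rightarrow> 'y set) \<Rightarrow> ('y \<Rightarrow> 'y) \<Rightarrow>
   ('y \<Rightarrow> 'x) \<Rightarrow> ('x \<Rightarrow> 'y) \<Rightarrow> ('x \<Rightarrow> 'x) \<Rightarrow> bool" where
  "deformation_retract sX GX dX sY GY dY i p h \<longleftrightarrow>
     quasi_isomorphism sY GY dY sX GX dX i \<and>
     quasi_isomorphism sX GX dX sY GY dY p \<and>
     graded_map sX GX sX GX 1 h \<and>
     (\<forall>x. i (p x) = x + dX (h x) + h (dX x)) \<and> (\<forall>y. p (i y) = y)"

definition special_deformation_retract ::
  "('r::comm_ring_1 \<Rightarrow> 'x::ab_group_add \<Rightarrow> 'x) \<Rightarrow> (int \<Rightarrow> 'x set) \<Rightarrow> ('x \<Rightarrow> 'x) \<Rightarrow>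
   ('r \<Rightarrow> 'y::ab_group_add \<Rightarrow> 'y) \<Rightarrow> (int \<Rightarrow> 'y set) \<Rightarrow> ('y \<Rightarrow> 'y) \<Rightarrow>
   ('y \<Rightarrow> 'x) \<Rightarrow> ('x \<Rightarrow> 'y) \<Rightarrow> ('x \<Rightarrow> 'x) \<Rightarrow> bool" where
  "special_deformation_retract sX GX dX sY GY dY i p h \<longleftrightarrow>
     deformation_retract sX GX dX sY GY dY i p h \<and>
     (\<forall>y. h (i y) = 0) \<and> (\<forall>x. p (h x) = 0) \<and> (\<forall>x. h (h x) = 0)"

text \<open>
  The elements of a complex are the homogeneous ones, so the rule
  \<open>h(ab) \<in> h(a)X + Xh(b)\<close> is only required for homogeneous \<open>a\<close> and \<open>b\<close>.
\<close>

definition generalized_leibniz ::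
  "(int \<Rightarrow> 'a::ab_group_add set) \<Rightarrow> ('a \<Rightarrow> 'a \<Rightarrow> 'a) \<Rightarrow> ('a \<Rightarrow> 'a) \<Rightarrow> bool" where
  "generalized_leibniz G m h \<longleftrightarrow>
     (\<forall>k l. \<forall>a\<in>G k. \<forall>b\<in>G l. \<exists>x y. h (m a b) = m (h a) x + m y (h b))"

definition perturbation ::
  "('r::comm_ring_1 \<Rightarrow> 'a::ab_group_add \<Rightarrow> 'a) \<Rightarrow> (int \<Rightarrow> 'a set) \<Rightarrow> ('a \<Rightarrow> 'a) \<Rightarrow>
   ('a \<Rightarrow> 'a) \<Rightarrow> bool" where
  "perturbation s G d \<delta> \<longleftrightarrow>
     graded_map s G s G (- 1) \<delta> \<and>
     (\<forall>x. d (d x + \<delta> x) + \<delta> (d x + \<delta> x) = 0)"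

definition small_perturbation ::
  "('r::comm_ring_1 \<Rightarrow> 'a::ab_group_add \<Rightarrow> 'a) \<Rightarrow> (int \<Rightarrow> 'a set) \<Rightarrow> ('a \<Rightarrow> 'a) \<Rightarrow>
   ('a \<Rightarrow> 'a) \<Rightarrow> ('a \<Rightarrow> 'a) \<Rightarrow> bool" where
  "small_perturbation s G d h \<delta> \<longleftrightarrow> perturbation s G d \<delta> \<and> bij (\<lambda>x. x - \<delta> (h x))"

definition pert_A :: "('x::ab_group_add \<Rightarrow> 'x) \<Rightarrow> ('x \<Rightarrow> 'x) \<Rightarrow> 'x \<Rightarrow> 'x" where
  "pert_A h \<delta> x = inv (\<lambda>z. z - \<delta> (h z)) (\<delta> x)"

definition pert_i ::
  "('y \<Rightarrow> 'x::ab_group_add) \<Rightarrow> ('x \<Rightarrow> 'x) \<Rightarrow> ('x \<Rightarrow> 'x) \<Rightarrow> 'y \<Rightarrow> 'x" where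
  "pert_i i h \<delta> y = i y + h (pert_A h \<delta> (i y))"

definition pert_p ::
  "('x::ab_group_add \<Rightarrow> 'y::ab_group_add) \<Rightarrow> ('x \<Rightarrow> 'x) \<Rightarrow> ('x \<Rightarrow> 'x) \<Rightarrow> 'x \<Rightarrow> 'y" where
  "pert_p p h \<delta> x = p x + p (pert_A h \<delta> (h x))"

definition pert_dX :: "('x::ab_group_add \<Rightarrow> 'x) \<Rightarrow> ('x \<Rightarrow> 'x) \<Rightarrow> 'x \<Rightarrow> 'x" where
  "pert_dX dX \<delta> x = dX x + \<delta> x"

definition pert_dY ::
  "('y::ab_group_add \<Rightarrow> 'y) \<Rightarrow> ('y \<Rightarrow> 'x::ab_group_add) \<Rightarrow> ('x \<Rightarrow> 'y) \<Rightarrow>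
   ('x \<Rightarrow> 'x) \<Rightarrow> ('x \<Rightarrow> 'x) \<Rightarrow> 'y \<Rightarrow> 'y" where
  "pert_dY dY i p h \<delta> y = dY y + p (pert_A h \<delta> (i y))"

definition transferred_product ::
  "('x::ab_group_add \<Rightarrow> 'x \<Rightarrow> 'x) \<Rightarrow> ('y \<Rightarrow> 'x) \<Rightarrow> ('x \<Rightarrow> 'y::ab_group_add) \<Rightarrow>
   ('x \<Rightarrow> 'x) \<Rightarrow> ('x \<Rightarrow> 'x) \<Rightarrow> 'y \<Rightarrow> 'y \<Rightarrow> 'y" where
  "transferred_product m i p h \<delta> \<alpha> \<beta> =
     pert_p p h \<delta> (m (pert_i i h \<delta> \<alpha>) (pert_i i h \<delta> \<beta>))"

text \<open>
  The hypotheses on \<open>h\<close> do not force \<open>h 1 = 0\<close>, and the transferred product has a unit preserved by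
  \<open>i\<^sub>\<infinity>\<close> only if \<open>h 1 = 0\<close>: if \<open>1 = i\<^sub>\<infinity> u\<close> then \<open>h 1 = h (i\<^sub>\<infinity> u) = 0\<close>, since \<open>h i = 0\<close> and \<open>h h = 0\<close>.
  Example with \<open>h 1 \<noteq> 0\<close> and no unit at all: \<open>X\<close> is the Koszul complex on \<open>- 1\<close> over
  \<open>S = R[\<epsilon>]/(\<epsilon>\<^sup>2)\<close>, with generator \<open>u\<close>, \<open>h (a + b\<epsilon>) = a u\<close>, \<open>h = 0\<close> in degree 1, \<open>\<delta> = 0\<close> and
  \<open>Y = R\<epsilon> \<oplus> R\<epsilon>u\<close>, whose product is zero. This is why the axioms on the unit are kept separate.
\<close>

end

theory Submission
  imports Defs
begin

text \<open>
  Put \<open>A = (1 - \<delta>h)\<^sup>-\<^sup>1 \<delta>\<close>, so that \<open>A = \<delta> + \<delta>hA = \<delta> + Ah\<delta>\<close>. The special conditions give \<open>h i\<^sub>\<infinity> = 0\<close> and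
  \<open>p\<^sub>\<infinity> i\<^sub>\<infinity> = 1\<close>, and \<open>AipA + A\<partial> + \<partial>A = 0\<close> makes \<open>i\<^sub>\<infinity>\<close> a chain map. If \<open>h x = 0\<close> and
  \<open>h (\<partial>\<^sub>\<infinity> x) = 0\<close>, then \<open>i\<^sub>\<infinity> p\<^sub>\<infinity> x = (1 - h\<delta>)\<^sup>-\<^sup>1 (x + h\<partial>x) = (1 - h\<delta>)\<^sup>-\<^sup>1 (x - h\<delta>x) = x\<close>. By the
  generalized Leibniz rule \<open>h\<close> kills every product of elements of the image of \<open>i\<^sub>\<infinity>\<close>, and by the
  Leibniz rule it kills the perturbed differential of such a product as well. Hence \<open>i\<^sub>\<infinity>\<close> is an
  injective multiplicative chain map, and \<open>Y\<close> inherits the axioms of \<open>X\<close>.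
\<close>

section \<open>Graded maps and homogeneous components\<close>

lemma graded_map_compose:
  assumes "graded_map s G s' G' k f" and "graded_map s' G' s'' G'' l g"
  shows "graded_map s G s'' G'' (k + l) (\<lambda>x. g (f x))"
proof -
  have "module_hom s s'' (\<lambda>x. g (f x))"
    using assms module_hom_compose[of s s' f s'' g] by (simp add: graded_map_def o_def)
  moreover have "g (f x) \<in> G'' (n + (k + l))" if "x \<in> G n" for n x
  proof -
    have "f x \<in> G' (n + k)"
      using assms(1) that by (auto simp: graded_map_def)
    then have "g (f x) \<in> G'' (n + k + l)"
      using assms(2) by (auto simp: graded_map_def)
    then show ?thesis by (simp add: add.assoc)
  qed
  ultimately show ?thesis by (auto simp: graded_map_def)
qed

lemma graded_map_in: "graded_map s G s' G' k f \<Longrightarrow> x \<in> G n \<Longrightarrow> f x \<in> G' (n + k)"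
  by (auto simp: graded_map_def)

context graded_module
begin

lemma graded_map_id: "graded_map s G s G 0 (\<lambda>x. x)"
  by (auto simp: graded_map_def module_hom_iff module_axioms)

lemma graded_map_add:
  assumes "graded_map s' G' s G k f" and "graded_map s' G' s G k g"
  shows "graded_map s' G' s G k (\<lambda>x. f x + g x)"
  using assms subspace_add[OF subspace_component]
  by (auto simp: graded_map_def module_hom_iff algebra_simps scale_right_distrib image_subset_iff)

lemma graded_map_diff:
  assumes "graded_map s' G' s G k f" and "graded_map s' G' s G k g"
  shows "graded_map s' G' s G k (\<lambda>x. f x - g x)"
  using assms subspace_diff[OF subspace_component]
  by (auto simp: graded_map_def module_hom_iff algebra_simps scale_right_diff_distrib image_subset_iff)

text \<open>Every element is a finite sum of homogeneous ones. This extends to all of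
  \<open>Y\<close> an identity that the generalized Leibniz rule gives for homogeneous arguments
  only.\<close>

lemma module_hom_eqI:
  assumes "module_hom s s' f" and "module_hom s s' g"
    and "\<And>n x. x \<in> G n \<Longrightarrow> f x = g x"
  shows "f x = g x"
proof -
  obtain N c where N: "\<forall>n\<in>N. c n \<in> G n" "x = (\<Sum>n\<in>N. c n)"
    using component_sum by metis
  have "f x = (\<Sum>n\<in>N. f (c n))"
    unfolding N(2) by (rule module_hom.sum[OF assms(1)])
  also have "\<dots> = (\<Sum>n\<in>N. g (c n))"
    using N(1) assms(3) by (intro sum.cong) auto
  also have "\<dots> = g x"
    unfolding N(2) by (rule module_hom.sum[OF assms(2), symmetric])
  finally show ?thesis .
qed

lemma component_unique:
  assumes "finite N" and "\<forall>k\<in>N. c k \<in> G k" and "(\<Sum>k\<in>N. c k) \<in> G n"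
    and "k \<in> N" and "k \<noteq> n"
  shows "c k = 0"
proof -
  let ?x = "\<Sum>k\<in>N. c k"
  \<comment> \<open>The degree \<open>n\<close> need not lie in \<open>N\<close>. Padding by zero
    lets the family \<open>c\<close> and the family concentrated at \<open>n\<close> with value
    \<open>?x\<close> be subtracted; the difference sums to 0, so independence applies.\<close>
  let ?N = "insert n N"
  let ?a = "\<lambda>k. if k \<in> N then c k else 0"
  let ?b = "\<lambda>k. if k = n then ?x else 0"
  have "?a k - ?b k \<in> G k" for k
    using assms(2,3) subspace_diff[OF subspace_component] subspace_0[OF subspace_component]
    by (smt (verit))
  moreover have "(\<Sum>k\<in>?N. ?a k - ?b k) = 0"
  proof -
    have "(\<Sum>k\<in>?N. ?a k) = ?x"
      by (rule sum.mono_neutral_cong_right) (use assms(1) in auto)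
    moreover have "(\<Sum>k\<in>?N. ?b k) = ?x"
      using assms(1) by (simp add: sum.delta)
    ultimately show ?thesis by (simp only: sum_subtractf diff_self)
  qed
  ultimately have "\<forall>k\<in>?N. ?a k - ?b k = 0"
    using component_indep[of ?N "\<lambda>k. ?a k - ?b k"] assms(1) by blast
  then have "?a k - ?b k = 0"
    using assms(4) by blast
  then show ?thesis using assms(4,5) by simp
qed

end

section \<open>Transfer of structure along injective graded maps\<close>

lemma inj_graded_map_reflects_degree:
  assumes "graded_module s G" and "graded_module s' G'"
    and f: "graded_map s G s' G' 0 f" and "inj f" and "f x \<in> G' n"
  shows "x \<in> G n"
proof -
  interpret X: graded_module s G by fact
  interpret X': graded_module s' G' by fact
  interpret f: module_hom s s' f using f by (simp add: graded_map_def)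
  obtain N c where N: "finite N" "\<forall>k\<in>N. c k \<in> G k" "x = (\<Sum>k\<in>N. c k)"
    using X.component_sum by metis
  have "\<forall>k\<in>N. f (c k) \<in> G' k"
    using N(2) graded_map_in[OF f] by fastforce
  moreover have "(\<Sum>k\<in>N. f (c k)) \<in> G' n"
    using assms(5) N(3) by (simp add: f.sum)
  ultimately have "f (c k) = 0" if "k \<in> N" "k \<noteq> n" for k
    using X'.component_unique[of N "\<lambda>k. f (c k)"] N(1) that by blast
  then have "c k = 0" if "k \<in> N" "k \<noteq> n" for k
    using \<open>inj f\<close> f.zero that by (metis injD)
  then have "c k \<in> G n" if "k \<in> N" for k
    using N(2) that X.subspace_0[OF X.subspace_component] by metis
  then show ?thesis
    unfolding N(3) by (intro X.subspace_sum[OF X.subspace_component])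
qed

text \<open>A bijective degree 0 map reflects degrees, so its inverse preserves them. Needed for
  \<open>1 - \<delta>h\<close>, whose inverse enters \<open>A\<close>.\<close>

lemma graded_map_inv:
  assumes "graded_module s G" and f: "graded_map s G s G 0 f" and "bij f"
  shows "graded_map s G s G 0 (inv f)"
proof -
  interpret f: module_hom s s f using f by (simp add: graded_map_def)
  have inv: "inv f y = x \<longleftrightarrow> y = f x" for x y
    using \<open>bij f\<close> by (metis bij_inv_eq_iff)
  have f_inv: "f (inv f y) = y" for y
    using \<open>bij f\<close> by (simp add: bij_is_surj surj_f_inv_f)
  have "module_hom s s (inv f)"
    using f.m1.module_axioms by (simp add: module_hom_iff inv f.add f.scale f_inv)
  moreover have "inv f y \<in> G n" if "y \<in> G n" for n y
    using inj_graded_map_reflects_degree[OF assms(1,1) f] \<open>bij f\<close> that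
    by (metis bij_is_inj f_inv)
  ultimately show ?thesis by (auto simp: graded_map_def)
qed

text \<open>Each axiom is an equation or a degree condition, and both can be tested after applying
  \<open>f\<close>: injectivity reflects equations, and \<open>f\<close> preserves and reflects
  degrees.\<close>

lemma nonunital_dg_algebra_reflect:
  assumes "nonunital_dg_algebra s G d m" and f: "chain_map s' G' d' s G d f"
    and "inj f" and "multiplicative m' m f"
  shows "nonunital_dg_algebra s' G' d' m'"
proof -
  interpret X: nonunital_dg_algebra s G d m by fact
  interpret Y: chain_complex s' G' d' using f by (simp add: chain_map_def)
  have gf: "graded_map s' G' s G 0 f" and fd: "f (d' y) = d (f y)" for y
    using f by (auto simp: chain_map_def)
  interpret f: module_hom s' s f using gf by (simp add: graded_map_def)
  have fm: "f (m' a b) = m (f a) (f b)" for a b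
    using assms(4) by (simp add: multiplicative_def)
  have eq: "a = b" if "f a = f b" for a b
    using \<open>inj f\<close> that by (rule injD)
  have deg: "y \<in> G' n \<longleftrightarrow> f y \<in> G n" for y n
    using inj_graded_map_reflects_degree[OF Y.graded_module_axioms X.graded_module_axioms gf]
      graded_map_in[OF gf] \<open>inj f\<close> by fastforce
  have fk: "f (koszul_sign k y) = koszul_sign k (f y)" for k y
    by (simp add: koszul_sign_def f.neg)
  interpret l: module_hom s s "\<lambda>a. m a b" for b by (rule X.linear_left)
  interpret r: module_hom s s "\<lambda>b. m a b" for a by (rule X.linear_right)
  show ?thesis
  proof (intro nonunital_dg_algebra.intro nonunital_dg_algebra_axioms.intro Y.chain_complex_axioms)
    fix n :: int assume "n < 0"
    then have "f y = 0" if "y \<in> G' n" for y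
      using that deg X.nonneg by blast
    then show "G' n = {0}"
      using eq[of _ 0] Y.subspace_0[OF Y.subspace_component] by auto
  next
    fix a
    show "module_hom s' s' (\<lambda>b. m' a b)"
      by (auto simp: module_hom_iff Y.module_axioms fm f.add f.scale r.add r.scale intro: eq)
  next
    fix b
    show "module_hom s' s' (\<lambda>a. m' a b)"
      by (auto simp: module_hom_iff Y.module_axioms fm f.add f.scale l.add l.scale intro: eq)
  next
    fix a b k l assume a: "a \<in> G' k" and b: "b \<in> G' l"
    then show "m' a b \<in> G' (k + l)"
      by (simp add: deg fm X.degree_mult)
    show "d' (m' a b) = m' (d' a) b + koszul_sign k (m' a (d' b))"
      using a b by (intro eq) (simp add: deg fd fm fk f.add X.leibniz[of _ k _ l])
    show "m' a b = koszul_sign (k * l) (m' b a)"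
      using a b by (intro eq) (simp add: deg fm fk X.graded_commute[of "f a" k "f b" l])
  next
    fix a b c
    show "m' (m' a b) c = m' a (m' b c)"
      by (intro eq) (simp add: fm X.assoc)
  next
    fix a k assume "a \<in> G' k" and "odd (k::int)"
    then show "m' a a = 0"
      by (intro eq) (simp add: deg fm f.zero X.odd_square)
  qed
qed

lemma dg_algebra_hom_reflect:
  assumes X: "dg_algebra s G d m e" and f: "chain_map s' G' d' s G d f"
    and "inj f" and mult: "multiplicative m' m f" and "f e' = e"
  shows "dg_algebra_hom s' G' d' m' e' s G d m e f"
proof -
  interpret X: dg_algebra s G d m e by fact
  interpret Y: nonunital_dg_algebra s' G' d' m'
    using nonunital_dg_algebra_reflect[OF X.nonunital_dg_algebra_axioms f \<open>inj f\<close> mult] .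
  have gf: "graded_map s' G' s G 0 f"
    using f by (auto simp: chain_map_def)
  have fm: "f (m' a b) = m (f a) (f b)" for a b
    using mult by (simp add: multiplicative_def)
  have "dg_algebra s' G' d' m' e'"
  proof
    show "e' \<in> G' 0"
      using inj_graded_map_reflects_degree[OF Y.graded_module_axioms X.graded_module_axioms gf]
        \<open>inj f\<close> \<open>f e' = e\<close> X.unit_degree by blast
    show "m' e' a = a" and "m' a e' = a" for a
      using \<open>inj f\<close> by (auto intro: injD simp: fm \<open>f e' = e\<close> X.unit_left X.unit_right)
  qed
  then show ?thesis
    using X f mult \<open>f e' = e\<close> by (simp add: dg_algebra_hom_def)
qed

section \<open>The perturbed retract\<close>

locale small_perturbed_retract =
  fixes sX :: "'r::comm_ring_1 \<Rightarrow> 'x::ab_group_add \<Rightarrow> 'x"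
    and sY :: "'r \<Rightarrow> 'y::ab_group_add \<Rightarrow> 'y"
    and GX :: "int \<Rightarrow> 'x set" and GY :: "int \<Rightarrow> 'y set"
    and dX :: "'x \<Rightarrow> 'x" and dY :: "'y \<Rightarrow> 'y"
    and i :: "'y \<Rightarrow> 'x" and p :: "'x \<Rightarrow> 'y" and h \<delta> :: "'x \<Rightarrow> 'x"
  assumes special: "special_deformation_retract sX GX dX sY GY dY i p h"
    and small: "small_perturbation sX GX dX h \<delta>"
begin

abbreviation "A \<equiv> pert_A h \<delta>"
abbreviation "i_inf \<equiv> pert_i i h \<delta>"
abbreviation "p_inf \<equiv> pert_p p h \<delta>"
abbreviation "dX_inf \<equiv> pert_dX dX \<delta>"
abbreviation "dY_inf \<equiv> pert_dY dY i p h \<delta>"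

lemma chain_map_i: "chain_map sY GY dY sX GX dX i"
  and chain_map_p: "chain_map sX GX dX sY GY dY p"
  and graded_h: "graded_map sX GX sX GX 1 h"
  and i_p: "i (p x) = x + dX (h x) + h (dX x)"
  and p_i: "p (i y) = y"
  and h_i: "h (i y) = 0"
  and p_h: "p (h x) = 0"
  and h_h: "h (h x) = 0"
  using special
  by (auto simp: special_deformation_retract_def deformation_retract_def quasi_isomorphism_def)

sublocale X: chain_complex sX GX dX
  using chain_map_i by (simp add: chain_map_def)

sublocale Y: chain_complex sY GY dY
  using chain_map_i by (simp add: chain_map_def)

lemma graded_i: "graded_map sY GY sX GX 0 i" and i_d: "i (dY y) = dX (i y)"
  and graded_p: "graded_map sX GX sY GY 0 p"
  and graded_\<delta>: "graded_map sX GX sX GX (- 1) \<delta>"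
  and dX_inf_sq: "dX_inf (dX_inf x) = 0"
  and bij: "bij (\<lambda>x. x - \<delta> (h x))"
  using chain_map_i chain_map_p small
  by (auto simp: chain_map_def small_perturbation_def perturbation_def pert_dX_def)

lemma graded_A: "graded_map sX GX sX GX (- 1) A"
proof -
  have "graded_map sX GX sX GX 0 (\<lambda>x. x - \<delta> (h x))"
    using X.graded_map_diff[OF X.graded_map_id] graded_map_compose[OF graded_h graded_\<delta>] by simp
  from graded_map_compose[OF graded_\<delta> graded_map_inv[OF X.graded_module_axioms this bij]]
  show ?thesis by (simp add: pert_A_def[abs_def])
qed

lemma graded_i_inf: "graded_map sY GY sX GX 0 i_inf"
  using X.graded_map_add[OF graded_i]
    graded_map_compose[OF graded_map_compose[OF graded_i graded_A] graded_h]
  by (simp add: pert_i_def[abs_def])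

lemma graded_dX_inf: "graded_map sX GX sX GX (- 1) dX_inf"
  using X.graded_map_add[OF X.graded_map_d graded_\<delta>] by (simp add: pert_dX_def[abs_def])

lemma graded_dY_inf: "graded_map sY GY sY GY (- 1) dY_inf"
  using Y.graded_map_add[OF Y.graded_map_d]
    graded_map_compose[OF graded_map_compose[OF graded_i graded_A] graded_p]
  by (simp add: pert_dY_def[abs_def])

sublocale i: module_hom sY sX i using graded_i by (simp add: graded_map_def)
sublocale p: module_hom sX sY p using graded_p by (simp add: graded_map_def)
sublocale h: module_hom sX sX h using graded_h by (simp add: graded_map_def)
sublocale d: module_hom sX sX dX using X.graded_map_d by (simp add: graded_map_def)
sublocale \<delta>: module_hom sX sX \<delta> using graded_\<delta> by (simp add: graded_map_def)
sublocale A: module_hom sX sX A using graded_A by (simp add: graded_map_def)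

lemma A_left: "A x - \<delta> (h (A x)) = \<delta> x"
  using surj_f_inv_f[OF bij_is_surj[OF bij]] unfolding pert_A_def .

text \<open>This is \<open>(1 - \<delta>h) \<delta> = \<delta> (1 - h\<delta>)\<close> after
  cancelling \<open>1 - \<delta>h\<close> on the left.\<close>

lemma A_right: "A (x - h (\<delta> x)) = \<delta> x"
proof -
  have "\<delta> (x - h (\<delta> x)) = \<delta> x - \<delta> (h (\<delta> x))"
    by (rule \<delta>.diff)
  then show ?thesis
    using inv_f_f[OF bij_is_inj[OF bij]] by (simp add: pert_A_def)
qed

lemma h_\<delta>_surj: "\<exists>z. x = z - h (\<delta> z)"
proof
  \<comment> \<open>The witness comes from \<open>1 + hA\<close>, a right inverse of
    \<open>1 - h\<delta>\<close> because \<open>A = \<delta> + \<delta>hA\<close>.\<close>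
  show "x = (x + h (A x)) - h (\<delta> (x + h (A x)))"
    using A_left[of x] by (simp add: h.add \<delta>.add flip: h.diff) (simp add: algebra_simps flip: h.add)
qed

lemma A_differential: "A (i (p (A x))) + A (dX x) + dX (A x) = 0"
proof -
  \<comment> \<open>Writing \<open>x = (1 - h\<delta>) z\<close> removes the inverse hidden in
    \<open>A\<close>, as \<open>A x\<close> becomes \<open>\<delta> z\<close>. Applying the
    injective map \<open>1 - \<delta>h\<close> to \<open>?w\<close> then leaves the expansion of
    \<open>dX_inf (dX_inf z)\<close>, which is 0.\<close>
  obtain z where x: "x = z - h (\<delta> z)"
    using h_\<delta>_surj by blast
  let ?w = "A (i (p (A x))) + A (dX x) + dX (A x)"
  have Ax: "A x = \<delta> z"
    by (simp add: x A_right)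
  have \<delta>_h_A: "\<delta> (h (A u)) = A u - \<delta> u" for u
    using A_left[of u] by (simp add: algebra_simps)
  have sq: "dX (\<delta> z) + \<delta> (dX z) + \<delta> (\<delta> z) = 0"
    using dX_inf_sq[of z] by (simp add: pert_dX_def d.add \<delta>.add X.d_d algebra_simps)
  have "?w - \<delta> (h ?w) = \<delta> (i (p (A x))) + \<delta> (dX x) + (dX (A x) - \<delta> (h (dX (A x))))"
    by (simp add: h.add \<delta>.add \<delta>_h_A algebra_simps)
  also have "\<dots> = dX (\<delta> z) + \<delta> (dX z) + \<delta> (\<delta> z)"
    by (simp add: Ax i_p) (simp add: x d.diff d.add \<delta>.diff \<delta>.add)
  finally have "?w - \<delta> (h ?w) = 0 - \<delta> (h 0)"
    by (simp add: sq h.zero \<delta>.zero)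
  then show ?thesis
    by (rule injD[OF bij_is_inj[OF bij]])
qed

lemma i_inf_d: "i_inf (dY_inf y) = dX_inf (i_inf y)"
proof -
  let ?a = "A (i y)"
  have "i_inf (dY_inf y) = dX (i y) + i (p ?a) + h (A (dX (i y)) + A (i (p ?a)))"
    by (simp add: pert_i_def pert_dY_def i.add A.add h.add i_d)
  also have "A (dX (i y)) + A (i (p ?a)) = - dX ?a"
    using A_differential[of "i y"] by (simp add: eq_neg_iff_add_eq_0 algebra_simps)
  \<comment> \<open>The homotopy formula for \<open>i (p ?a)\<close> contributes
    \<open>h (dX ?a)\<close>, which cancels.\<close>
  also have "dX (i y) + i (p ?a) + h (- dX ?a) = dX (i y) + ?a + dX (h ?a)"
    by (simp add: i_p h.neg)
  also have "\<dots> = dX_inf (i_inf y)"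
    using A_left[of "i y"] by (simp add: pert_dX_def pert_i_def d.add \<delta>.add algebra_simps)
  finally show ?thesis .
qed

lemma h_i_inf: "h (i_inf y) = 0"
  by (simp add: pert_i_def h.add h_i h_h)

lemma p_inf_i_inf: "p_inf (i_inf y) = y"
  by (simp add: pert_p_def h_i_inf A.zero p.zero) (simp add: pert_i_def p.add p_i p_h)

lemma inj_i_inf: "inj i_inf"
  by (metis injI p_inf_i_inf)

text \<open>A membership test for the image of \<open>i_inf\<close>. Elements of that image satisfy
  both conditions, since \<open>h\<close> kills the image and \<open>dX_inf\<close> preserves
  it.\<close>

lemma i_inf_p_inf:
  assumes "h x = 0" and "h (dX_inf x) = 0"
  shows "i_inf (p_inf x) = x"
proof -
  have "h (dX x) = - h (\<delta> x)"
    using assms(2) by (simp add: pert_dX_def h.add eq_neg_iff_add_eq_0)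
  then have "i (p x) = x - h (\<delta> x)"
    by (simp add: i_p assms(1) d.zero)
  moreover have "p_inf x = p x"
    by (simp add: pert_p_def assms(1) A.zero p.zero)
  ultimately show ?thesis
    by (simp add: pert_i_def A_right)
qed

lemma chain_map_i_inf: "chain_map sY GY dY_inf sX GX dX_inf i_inf"
proof -
  have "chain_complex sX GX dX_inf"
    by unfold_locales (simp_all add: graded_dX_inf dX_inf_sq)
  \<comment> \<open>Pulled back from \<open>dX_inf_sq\<close> along the injective map
    \<open>i_inf\<close>.\<close>
  moreover have "dY_inf (dY_inf y) = 0" for y
  proof -
    have "i_inf (dY_inf (dY_inf y)) = i_inf 0"
      by (simp add: i_inf_d dX_inf_sq) (simp add: pert_i_def i.zero A.zero h.zero)
    then show ?thesis by (rule injD[OF inj_i_inf])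
  qed
  then have "chain_complex sY GY dY_inf"
    by unfold_locales (simp_all add: graded_dY_inf)
  ultimately show ?thesis
    by (simp add: chain_map_def graded_i_inf i_inf_d)
qed

section \<open>Products and the unit\<close>

lemma multiplicative_i_inf:
  assumes "nonunital_dg_algebra sX GX dX_inf m" and "generalized_leibniz GX m h"
  shows "multiplicative (transferred_product m i p h \<delta>) m i_inf"
proof -
  interpret X': nonunital_dg_algebra sX GX dX_inf m by fact
  interpret l: module_hom sX sX "\<lambda>a. m a b" for b by (rule X'.linear_left)
  interpret r: module_hom sX sX "\<lambda>b. m a b" for a by (rule X'.linear_right)
  interpret j: module_hom sY sX i_inf using graded_i_inf by (simp add: graded_map_def)
  have deg: "i_inf y \<in> GX n" if "y \<in> GY n" for y n
    using graded_map_in[OF graded_i_inf that] by simp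
  have degd: "dY_inf y \<in> GY (n - 1)" if "y \<in> GY n" for y n
    using graded_map_in[OF graded_dY_inf that] by simp
  have kill: "h (m (i_inf a) (i_inf b)) = 0" if ab: "a \<in> GY k" "b \<in> GY n" for a b k n
  proof -
    obtain x y where "h (m (i_inf a) (i_inf b)) = m (h (i_inf a)) x + m y (h (i_inf b))"
      using assms(2) deg[OF ab(1)] deg[OF ab(2)] unfolding generalized_leibniz_def by blast
    then show ?thesis by (simp add: h_i_inf l.zero r.zero)
  qed
  let ?P = "\<lambda>a b. i_inf (p_inf (m (i_inf a) (i_inf b)))"
  let ?Q = "\<lambda>a b. m (i_inf a) (i_inf b)"
  have homog: "?P a b = ?Q a b" if a: "a \<in> GY k" and b: "b \<in> GY n" for a b k n
  proof (rule i_inf_p_inf)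
    show "h (?Q a b) = 0"
      using kill[OF a b] .
    \<comment> \<open>Since \<open>i_inf\<close> is a chain map, both terms are again products of
      homogeneous elements of its image, so \<open>kill\<close> applies to each.\<close>
    have "dX_inf (?Q a b) = ?Q (dY_inf a) b + koszul_sign k (?Q a (dY_inf b))"
      by (simp add: X'.leibniz[OF deg[OF a] deg[OF b]] i_inf_d)
    then show "h (dX_inf (?Q a b)) = 0"
      using kill[OF degd[OF a] b] kill[OF a degd[OF b]]
      by (simp add: koszul_sign_def h.add h.neg)
  qed
  have lin: "module_hom sY sX (\<lambda>b. ?P a b)" "module_hom sY sX (\<lambda>a. ?P a b)"
    "module_hom sY sX (\<lambda>b. ?Q a b)" "module_hom sY sX (\<lambda>a. ?Q a b)" for a b
    by (simp_all add: module_hom_iff X.module_axioms Y.module_axioms pert_p_def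
        j.add j.scale l.add l.scale r.add r.scale p.add p.scale h.add h.scale A.add A.scale
        algebra_simps Y.scale_right_distrib)
  \<comment> \<open>Bilinear extension from homogeneous arguments, first in \<open>b\<close> and
    then in \<open>a\<close>.\<close>
  have "?P a b = ?Q a b" if "a \<in> GY k" for a b k
    using Y.module_hom_eqI[OF lin(1,3)] homog[OF that] by blast
  then have "?P a b = ?Q a b" for a b
    using Y.module_hom_eqI[OF lin(2,4)] by blast
  then show ?thesis
    by (simp add: multiplicative_def transferred_product_def)
qed

text \<open>The unit has degree 0, so its perturbed differential lies in degree -1, where
  \<open>X\<close> vanishes.\<close>

lemma i_inf_unit:
  assumes "dg_algebra sX GX dX_inf m e" and "h e = 0"
  shows "i_inf (p_inf e) = e"
proof (rule i_inf_p_inf[OF assms(2)])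
  interpret X': dg_algebra sX GX dX_inf m e by fact
  have "dX_inf e \<in> GX (- 1)"
    using graded_map_in[OF graded_dX_inf X'.unit_degree] by simp
  then show "h (dX_inf e) = 0"
    using X'.nonneg[of "- 1"] by (simp add: h.zero)
qed

end

theorem proposition3p5:
  fixes sX :: "'r::comm_ring_1 \<Rightarrow> 'x::ab_group_add \<Rightarrow> 'x"
    and sY :: "'r \<Rightarrow> 'y::ab_group_add \<Rightarrow> 'y"
    and GX :: "int \<Rightarrow> 'x set" and GY :: "int \<Rightarrow> 'y set"
    and dX :: "'x \<Rightarrow> 'x" and dY :: "'y \<Rightarrow> 'y"
    and mX :: "'x \<Rightarrow> 'x \<Rightarrow> 'x" and oneX :: 'x
    and i :: "'y \<Rightarrow> 'x" and p :: "'x \<Rightarrow> 'y" and h \<delta> :: "'x \<Rightarrow> 'x"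
  assumes "dg_algebra sX GX dX mX oneX"
    and "special_deformation_retract sX GX dX sY GY dY i p h"
    and "generalized_leibniz GX mX h"
    and "small_perturbation sX GX dX h \<delta>"
    and "dg_algebra sX GX (pert_dX dX \<delta>) mX oneX"
  shows "nonunital_dg_algebra sY GY (pert_dY dY i p h \<delta>) (transferred_product mX i p h \<delta>) \<and>
    chain_map sY GY (pert_dY dY i p h \<delta>) sX GX (pert_dX dX \<delta>) (pert_i i h \<delta>) \<and>
    multiplicative (transferred_product mX i p h \<delta>) mX (pert_i i h \<delta>) \<and>
    (h oneX = 0 \<longrightarrow>
      (\<exists>oneY.
        dg_algebra sY GY (pert_dY dY i p h \<delta>) (transferred_product mX i p h \<delta>) oneY \<and>
        dg_algebra_hom sY GY (pert_dY dY i p h \<delta>) (transferred_product mX i p h \<delta>) oneY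
          sX GX (pert_dX dX \<delta>) mX oneX (pert_i i h \<delta>)))"
proof -
  interpret small_perturbed_retract sX sY GX GY dX dY i p h \<delta>
    by unfold_locales (fact assms)+
  interpret X': dg_algebra sX GX dX_inf mX oneX by fact
  have mult: "multiplicative (transferred_product mX i p h \<delta>) mX i_inf"
    using multiplicative_i_inf[OF X'.nonunital_dg_algebra_axioms assms(3)] .
  \<comment> \<open>When \<open>h oneX = 0\<close>, the unit of \<open>Y\<close> is
    \<open>p_inf oneX\<close>, which \<open>i_inf\<close> sends to \<open>oneX\<close>.\<close>
  show ?thesis
    using nonunital_dg_algebra_reflect[OF X'.nonunital_dg_algebra_axioms chain_map_i_inf inj_i_inf mult]
      dg_algebra_hom_reflect[OF assms(5) chain_map_i_inf inj_i_inf mult i_inf_unit[OF assms(5)]]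
      chain_map_i_inf mult
    by (auto simp: dg_algebra_hom_def)
qed

end
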